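(* Let $\Omega\subset\mathbb{R}^N$ be open and let $F:\Omega\times\mathbb{R}\times\mathbb{R}^N\times\mathbb{S}^N\to\mathbb{R}$ satisfy (F1), (F2), (F3) and (F5). Let $U$ be an open subset of $\Omega$, and assume that $U$ satisfies (G$_{F,\Omega}$). Then there exists a viscosity supersolution $v\in\mathrm{LSC}(\Omega)$ of $F(x,v,Dv,D^2v)=0$ in $\Omega$ such that $$\min_{\Omega}v=0\quad\text{and}\quad U=\{x\in\Omega : v(x)>0\}.$$
   Context: $\mathbb{S}^N$ is the space of real symmetric $N\times N$ matrices with its usual order. Hypotheses on $F$: (F1) $F$ is continuous. (F2) $F(x,r,p,X)\le F(x,r,p,Y)$ whenever $X\le Y$. (F3) $F(x,0,0,0)\le 0$ for all $x\in\Omega$. (F5) $F(x,r,p,X)\le F(x,0,p,X)$ whenever $r\ge 0$. Condition (G$_{F,\Omega}$) for an open set $U\subset\Omega$: if $\phi\in C^2(\Omega)$, $\hat x\in\Omega\setminus U$ and $\phi\le\phi(\hat x)=0$ in $\Omega\setminus U$, then $F(\hat x,\phi(\hat x),D\phi(\hat x),D^2\phi(\hat x))\le 0$. $\mathrm{LSC}(\Omega)$ is the set of lower semicontinuous functions $\Omega\to\mathbb{R}$. A function $v\in\mathrm{LSC}(\Omega)$ is a (viscosity) supersolution of $F(x,v,Dv,D^2v)=0$ in $\Omega$ if, whenever $\phi\in C^2(\Omega)$ and $v-\phi$ has a local minimum at $\hat x\in\Omega$, one has $F(\hat x,v(\hat x),D\phi(\hat x),D^2\phi(\hat x))\le 0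$.
   Formalization: U is assumed to be a proper subset of Ω; for U = Ω the condition (G) is vacuous and the conclusion is impossible, since min v = 0 needs a point of Ω where v = 0, while U = {v > 0} = Ω allows none. *)

theory Defs
  imports "HOL-Analysis.Analysis"
begin

definition sym_mats :: "(real^'n^'n) set" where
  "sym_mats = {X. transpose X = X}"

(* The library order on vectors of vectors is componentwise; the order on symmetric
   matrices is that of the associated quadratic forms. *)
definition sym_le :: "real^'n^'n \<Rightarrow> real^'n^'n \<Rightarrow> bool" where
  "sym_le X Y \<longleftrightarrow> (\<forall>\<xi>. \<xi> \<bullet> (X *v \<xi>) \<le> \<xi> \<bullet> (Y *v \<xi>))"

definition grad :: "(real^'n \<Rightarrow> real) \<Rightarrow> real^'n \<Rightarrow> real^'n" where
  "grad \<phi> x = (\<chi> i. frechet_derivative \<phi> (at x) (axis i 1))"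

definition hess :: "(real^'n \<Rightarrow> real) \<Rightarrow> real^'n \<Rightarrow> real^'n^'n" where
  "hess \<phi> x = jacobian (grad \<phi>) (at x)"

(* Meant for open \<Omega>, as are the notions below: derivatives are full derivatives at
   points of \<Omega>, and only the values of \<phi> on \<Omega> matter. *)
definition C2_on :: "(real^'n) set \<Rightarrow> (real^'n \<Rightarrow> real) \<Rightarrow> bool" where
  "C2_on \<Omega> \<phi> \<longleftrightarrow>
     (\<forall>x\<in>\<Omega>. \<phi> differentiable (at x)) \<and>
     (\<forall>x\<in>\<Omega>. grad \<phi> differentiable (at x)) \<and>
     continuous_on \<Omega> (hess \<phi>)"

definition LSC :: "(real^'n) set \<Rightarrow> (real^'n \<Rightarrow> real) \<Rightarrow> bool" where
  "LSC \<Omega> v \<longleftrightarrow> (\<forall>x\<in>\<Omega>. \<forall>a. a < v x \<longrightarrow> (\<forall>\<^sub>F y in at x within \<Omega>. a < v y))"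

definition local_min_on :: "(real^'n) set \<Rightarrow> (real^'n \<Rightarrow> real) \<Rightarrow> real^'n \<Rightarrow> bool" where
  "local_min_on \<Omega> f x \<longleftrightarrow> x \<in> \<Omega> \<and> (\<forall>\<^sub>F y in at x within \<Omega>. f x \<le> f y)"

(* An operator on \<Omega> \<times> \<real> \<times> \<real>^N \<times> S^N is a curried total function, whose values matter only
   for x in \<Omega> and symmetric X. *)
type_synonym 'n operator = "real^'n \<Rightarrow> real \<Rightarrow> real^'n \<Rightarrow> real^'n^'n \<Rightarrow> real"

definition F1 :: "(real^'n) set \<Rightarrow> 'n::finite operator \<Rightarrow> bool" where
  "F1 \<Omega> F \<longleftrightarrow>
     continuous_on (\<Omega> \<times> UNIV \<times> UNIV \<times> sym_mats) (\<lambda>(x, r, p, X). F x r p X)"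

definition F2 :: "(real^'n) set \<Rightarrow> 'n::finite operator \<Rightarrow> bool" where
  "F2 \<Omega> F \<longleftrightarrow>
     (\<forall>x\<in>\<Omega>. \<forall>r p. \<forall>X\<in>sym_mats. \<forall>Y\<in>sym_mats. sym_le X Y \<longrightarrow> F x r p X \<le> F x r p Y)"

definition F3 :: "(real^'n) set \<Rightarrow> 'n::finite operator \<Rightarrow> bool" where
  "F3 \<Omega> F \<longleftrightarrow> (\<forall>x\<in>\<Omega>. F x 0 0 0 \<le> 0)"

definition F5 :: "(real^'n) set \<Rightarrow> 'n::finite operator \<Rightarrow> bool" where
  "F5 \<Omega> F \<longleftrightarrow> (\<forall>x\<in>\<Omega>. \<forall>r\<ge>0. \<forall>p. \<forall>X\<in>sym_mats. F x r p X \<le> F x 0 p X)"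

definition G_cond :: "'n::finite operator \<Rightarrow> (real^'n) set \<Rightarrow> (real^'n) set \<Rightarrow> bool" where
  "G_cond F \<Omega> U \<longleftrightarrow>
     (\<forall>\<phi> xh. C2_on \<Omega> \<phi> \<and> xh \<in> \<Omega> - U \<and> (\<forall>x\<in>\<Omega> - U. \<phi> x \<le> \<phi> xh) \<and> \<phi> xh = 0
        \<longrightarrow> F xh (\<phi> xh) (grad \<phi> xh) (hess \<phi> xh) \<le> 0)"

definition viscosity_supersolution ::
  "'n::finite operator \<Rightarrow> (real^'n) set \<Rightarrow> (real^'n \<Rightarrow> real) \<Rightarrow> bool" where
  "viscosity_supersolution F \<Omega> v \<longleftrightarrow>
     LSC \<Omega> v \<and>
     (\<forall>\<phi> xh. C2_on \<Omega> \<phi> \<and> local_min_on \<Omega> (\<lambda>x. v x - \<phi> x) xh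
        \<longrightarrow> F xh (v xh) (grad \<phi> xh) (hess \<phi> xh) \<le> 0)"

end

theory Submission
  imports Defs
begin

text \<open>
  The solution is the indicator function of \<open>U\<close>. At a point of \<open>U\<close> a test function touching it from
  below has a local maximum, so ellipticity and (F3), (F5) apply. At a point \<open>a\<close> outside \<open>U\<close> a
  test function \<open>\<phi>\<close> satisfies \<open>\<phi> \<le> \<phi>(a)\<close> outside \<open>U\<close>, but only near \<open>a\<close>. By Taylor expansion the
  same holds for the quadratic polynomial with gradient \<open>D\<phi>(a)\<close> and Hessian \<open>D\<^sup>2\<phi>(a) - \<epsilon>I\<close>; subtracting
  \<open>M|x - a|\<^sup>4\<close> with \<open>M\<close> large makes the inequality global without changing the derivatives at \<open>a\<close>.
  Condition (G) applies to this polynomial, and \<open>\<epsilon> \<rightarrow> 0\<close> concludes by (F1).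
\<close>

section \<open>Gradient and Hessian as derivatives\<close>

lemma grad_has_derivative:
  assumes "\<phi> differentiable (at x)"
  shows "(\<phi> has_derivative (\<lambda>h. grad \<phi> x \<bullet> h)) (at x)"
proof -
  let ?D = "frechet_derivative \<phi> (at x)"
  have D: "(\<phi> has_derivative ?D) (at x)"
    using assms frechet_derivative_works by blast
  then have lin: "linear ?D"
    by (rule has_derivative_linear)
  have "?D h = grad \<phi> x \<bullet> h" for h
  proof -
    have "?D h = ?D (\<Sum>i\<in>UNIV. h $ i *\<^sub>R axis i 1)"
      by (simp add: basis_expansion flip: scalar_mult_eq_scaleR)
    also have "\<dots> = (\<Sum>i\<in>UNIV. h $ i * ?D (axis i 1))"
      by (simp add: linear_sum[OF lin] linear_cmul[OF lin])
    also have "\<dots> = grad \<phi> x \<bullet> h"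
      by (simp add: grad_def inner_vec_def mult.commute)
    finally show ?thesis .
  qed
  then have "?D = (\<lambda>h. grad \<phi> x \<bullet> h)"
    by blast
  with D show ?thesis
    by simp
qed

lemma grad_eqI:
  assumes "(\<phi> has_derivative (\<lambda>h. g \<bullet> h)) (at x)"
  shows "grad \<phi> x = g"
  by (simp add: grad_def vec_eq_iff inner_axis frechet_derivative_at[OF assms, symmetric])

lemma hess_eqI:
  assumes "(grad \<phi> has_derivative (\<lambda>h. X *v h)) (at x)"
  shows "hess \<phi> x = X"
  by (simp add: hess_def jacobian_def frechet_derivative_at[OF assms, symmetric])

lemma hess_has_derivative:
  assumes "grad \<phi> differentiable (at x)"
  shows "(grad \<phi> has_derivative (\<lambda>h. hess \<phi> x *v h)) (at x)"
  using assms by (simp add: hess_def flip: jacobian_works)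

lemma has_real_derivative_along_line:
  assumes "\<phi> differentiable (at (c + t *\<^sub>R u))"
  shows "((\<lambda>s. \<phi> (c + s *\<^sub>R u)) has_real_derivative grad \<phi> (c + t *\<^sub>R u) \<bullet> u) (at t)"
proof -
  have "((\<lambda>s. c + s *\<^sub>R u) has_derivative (\<lambda>s. s *\<^sub>R u)) (at t)"
    by (auto intro!: derivative_eq_intros)
  from has_derivative_compose[OF this grad_has_derivative[OF assms]]
  show ?thesis
    by (simp add: has_field_derivative_def mult_commute_abs)
qed

section \<open>A second-order Taylor estimate\<close>

lemma grad_linearization:
  assumes "(grad \<phi> has_derivative (\<lambda>h. X *v h)) (at x)" and "0 < e"
  obtains d where "0 < d"
    and "\<And>z. norm z < d \<Longrightarrow> norm (grad \<phi> (x + z) - grad \<phi> x - X *v z) \<le> e * norm z"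
proof -
  obtain d where d: "0 < d"
    "\<And>y. norm (y - x) < d \<Longrightarrow> norm (grad \<phi> y - grad \<phi> x - X *v (y - x)) \<le> e * norm (y - x)"
    using assms unfolding has_derivative_at_alt by blast
  show thesis
    by (rule that[OF d(1)]) (use d(2)[of "x + _"] in simp)
qed

text \<open>Along the segment from \<open>x\<close> to \<open>x + z\<close>, subtracting the claimed
  quadratic bound from \<open>\<phi>\<close> leaves a nondecreasing function: the term with
  \<open>e\<close> absorbs the error in linearizing the gradient. The gradient need only be
  differentiable at the single point \<open>x\<close>.\<close>

lemma taylor_lower_bound:
  assumes "open S" "x \<in> S" and diff: "\<And>y. y \<in> S \<Longrightarrow> \<phi> differentiable (at y)"
    and X: "(grad \<phi> has_derivative (\<lambda>h. X *v h)) (at x)" and "0 < e"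
  obtains d where "0 < d"
    and "\<And>z. norm z < d \<Longrightarrow>
          \<phi> x + grad \<phi> x \<bullet> z + (z \<bullet> (X *v z) - e * (norm z)\<^sup>2) / 2 \<le> \<phi> (x + z)"
proof -
  obtain d1 where d1: "0 < d1" "ball x d1 \<subseteq> S"
    using \<open>open S\<close> \<open>x \<in> S\<close> openE by blast
  obtain d2 where d2: "0 < d2"
    "\<And>z. norm z < d2 \<Longrightarrow> norm (grad \<phi> (x + z) - grad \<phi> x - X *v z) \<le> e * norm z"
    using grad_linearization[OF X \<open>0 < e\<close>] by blast
  have "\<phi> x + grad \<phi> x \<bullet> z + (z \<bullet> (X *v z) - e * (norm z)\<^sup>2) / 2 \<le> \<phi> (x + z)"
    if z: "norm z < min d1 d2" for z
  proof -
    define c where "c = z \<bullet> (X *v z) - e * (norm z)\<^sup>2"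
    define g where "g t = \<phi> (x + t *\<^sub>R z) - t * (grad \<phi> x \<bullet> z) - t\<^sup>2 * (c / 2)" for t
    define g' where "g' t = grad \<phi> (x + t *\<^sub>R z) \<bullet> z - grad \<phi> x \<bullet> z - t * c" for t
    have "(g has_real_derivative g' t) (at t) \<and> 0 \<le> g' t" if t: "0 \<le> t" "t \<le> 1" for t
    proof
      have small: "norm (t *\<^sub>R z) < min d1 d2"
        using z t mult_right_mono[of t 1 "norm z"] by simp
      then have "x + t *\<^sub>R z \<in> S"
        using d1 by (auto simp: dist_norm)
      from has_real_derivative_along_line[OF diff[OF this]]
      show "(g has_real_derivative g' t) (at t)"
        unfolding g_def g'_def by (auto intro!: derivative_eq_intros)
      \<comment> \<open>The linearization error of the gradient at \<open>x + t *\<^sub>R z\<close>.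
        Its product with \<open>z\<close> is at least -t e |z|^2, exactly what the
        \<open>e\<close>-part of \<open>c\<close> adds back in \<open>g' t\<close>.\<close>
      let ?r = "grad \<phi> (x + t *\<^sub>R z) - grad \<phi> x - X *v (t *\<^sub>R z)"
      have "\<bar>?r \<bullet> z\<bar> \<le> norm ?r * norm z"
        by (rule Cauchy_Schwarz_ineq2)
      also have "\<dots> \<le> e * norm (t *\<^sub>R z) * norm z"
        using d2(2)[of "t *\<^sub>R z"] small by (intro mult_right_mono) auto
      finally have "- (t * (e * (norm z)\<^sup>2)) \<le> ?r \<bullet> z"
        using t by (simp add: power2_eq_square mult_ac)
      moreover have "g' t = ?r \<bullet> z + t * (e * (norm z)\<^sup>2)"
        by (simp add: g'_def c_def inner_diff_right matrix_vector_mult_scaleR inner_commute[of _ z]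
            right_diff_distrib)
      ultimately show "0 \<le> g' t"
        by simp
    qed
    then have "g 0 \<le> g 1"
      by (intro DERIV_nonneg_imp_nondecreasing[of 0 1 g]) (simp, blast)
    then show ?thesis
      by (simp add: g_def c_def)
  qed
  with that[of "min d1 d2"] d1(1) d2(1) show thesis
    by simp
qed

section \<open>Symmetry of the Hessian\<close>

text \<open>The second difference is the increment over [0,1] of t \<mapsto> \<phi>(x + v + tu) -
  \<phi>(x + tu). The mean value theorem turns it into a difference of two gradients paired with
  \<open>u\<close>, and both are linearized at \<open>x\<close>.\<close>

lemma second_difference_estimate:
  assumes "open S" "x \<in> S" and diff: "\<And>y. y \<in> S \<Longrightarrow> \<phi> differentiable (at y)"
    and X: "(grad \<phi> has_derivative (\<lambda>h. X *v h)) (at x)" and "0 < e"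
  obtains d where "0 < d"
    and "\<And>u v. norm u + norm v < d \<Longrightarrow>
          \<bar>\<phi> (x + u + v) - \<phi> (x + u) - \<phi> (x + v) + \<phi> x - u \<bullet> (X *v v)\<bar>
            \<le> e * (norm u + norm v)\<^sup>2"
proof -
  obtain d1 where d1: "0 < d1" "ball x d1 \<subseteq> S"
    using \<open>open S\<close> \<open>x \<in> S\<close> openE by blast
  \<comment> \<open>Half of \<open>e\<close>, because two linearization errors are added below, at
    \<open>v + t *\<^sub>R u\<close> and at \<open>t *\<^sub>R u\<close>.\<close>
  have "0 < e / 2"
    using \<open>0 < e\<close> by simp
  then obtain d2 where d2: "0 < d2"
    "\<And>z. norm z < d2 \<Longrightarrow> norm (grad \<phi> (x + z) - grad \<phi> x - X *v z) \<le> e / 2 * norm z"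
    using grad_linearization[OF X] by blast
  have "\<bar>\<phi> (x + u + v) - \<phi> (x + u) - \<phi> (x + v) + \<phi> x - u \<bullet> (X *v v)\<bar> \<le> e * (norm u + norm v)\<^sup>2"
    if uv: "norm u + norm v < min d1 d2" for u v
  proof -
    define g where "g t = \<phi> (x + v + t *\<^sub>R u) - \<phi> (x + t *\<^sub>R u)" for t
    define g' where "g' t = grad \<phi> (x + v + t *\<^sub>R u) \<bullet> u - grad \<phi> (x + t *\<^sub>R u) \<bullet> u" for t
    have size: "norm (t *\<^sub>R u) \<le> norm u + norm v" "norm (v + t *\<^sub>R u) \<le> norm u + norm v"
      if t: "0 \<le> t" "t \<le> 1" for t
    proof -
      have "norm (t *\<^sub>R u) \<le> norm u"
        using t mult_right_mono[of t 1 "norm u"] by simp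
      then show "norm (t *\<^sub>R u) \<le> norm u + norm v" "norm (v + t *\<^sub>R u) \<le> norm u + norm v"
        using norm_triangle_ineq[of v "t *\<^sub>R u"] norm_ge_zero[of v] by linarith+
    qed
    have "(g has_real_derivative g' t) (at t)" if t: "0 \<le> t" "t \<le> 1" for t
    proof -
      have "x + t *\<^sub>R u \<in> S" "x + v + t *\<^sub>R u \<in> S"
        using size[OF t] uv d1 by (auto simp: dist_norm subset_iff norm_minus_commute add.assoc)
      from this[THEN diff, THEN has_real_derivative_along_line]
      show ?thesis
        unfolding g_def g'_def by (auto intro!: derivative_eq_intros)
    qed
    then obtain t where t: "0 < t" "t < 1" "g 1 - g 0 = (1 - 0) * g' t"
      using MVT2[of 0 1 g g'] by auto
    let ?r = "\<lambda>z. grad \<phi> (x + z) - grad \<phi> x - X *v z"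
    have r: "norm (?r z) \<le> e / 2 * (norm u + norm v)" if "norm z \<le> norm u + norm v" for z
    proof -
      have "norm (?r z) \<le> e / 2 * norm z"
        using that uv by (intro d2(2)) auto
      also have "\<dots> \<le> e / 2 * (norm u + norm v)"
        using that \<open>0 < e\<close> by (intro mult_left_mono) auto
      finally show ?thesis .
    qed
    have "g 1 - g 0 - u \<bullet> (X *v v) = (?r (v + t *\<^sub>R u) - ?r (t *\<^sub>R u)) \<bullet> u"
      using t(3) by (simp add: g'_def add.assoc inner_diff_right inner_add_right matrix_vector_right_distrib
          inner_commute[of _ u])
    also have "\<bar>\<dots>\<bar> \<le> norm (?r (v + t *\<^sub>R u) - ?r (t *\<^sub>R u)) * norm u"
      by (rule Cauchy_Schwarz_ineq2)
    also have "\<dots> \<le> (e * (norm u + norm v)) * (norm u + norm v)"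
      using norm_triangle_ineq4[of "?r (v + t *\<^sub>R u)" "?r (t *\<^sub>R u)"] t(1,2)
        r[OF size(1)[of t]] r[OF size(2)[of t]] \<open>0 < e\<close>
      by (intro mult_mono) auto
    finally show ?thesis
      by (simp add: g_def power2_eq_square algebra_simps)
  qed
  with that[of "min d1 d2"] d1(1) d2(1) show thesis
    by simp
qed

text \<open>Schwarz's theorem: the second difference is symmetric in its two increments.\<close>

lemma second_derivative_symmetric:
  assumes "open S" "x \<in> S" and diff: "\<And>y. y \<in> S \<Longrightarrow> \<phi> differentiable (at y)"
    and X: "(grad \<phi> has_derivative (\<lambda>h. X *v h)) (at x)"
  shows "X \<in> sym_mats"
proof -
  have sym: "u \<bullet> (X *v v) = v \<bullet> (X *v u)" for u v
  proof -
    define N where "N = norm u + norm v"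
    have N: "0 \<le> N"
      by (simp add: N_def)
    have "\<bar>u \<bullet> (X *v v) - v \<bullet> (X *v u)\<bar> \<le> 2 * e * N\<^sup>2" if "0 < e" for e
    proof -
      obtain d where d: "0 < d"
        "\<And>u v. norm u + norm v < d \<Longrightarrow>
          \<bar>\<phi> (x + u + v) - \<phi> (x + u) - \<phi> (x + v) + \<phi> x - u \<bullet> (X *v v)\<bar>
            \<le> e * (norm u + norm v)\<^sup>2"
        using second_difference_estimate[OF assms \<open>0 < e\<close>] by blast
      \<comment> \<open>Scaling both increments by \<open>h\<close> brings them into the range of
        the estimate. Both sides are homogeneous of degree 2, so the factor h^2 cancels
        afterwards.\<close>
      define h where "h = d / (2 * (N + 1))"
      have h: "0 < h" "h * N < d"
        using d(1) N by (auto simp: h_def field_simps add_nonneg_pos)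
      have hN: "norm (h *\<^sub>R u) + norm (h *\<^sub>R v) = h * N"
        "norm (h *\<^sub>R v) + norm (h *\<^sub>R u) = h * N"
        using h by (simp_all add: N_def algebra_simps)
      have "\<bar>(h *\<^sub>R u) \<bullet> (X *v (h *\<^sub>R v)) - (h *\<^sub>R v) \<bullet> (X *v (h *\<^sub>R u))\<bar> \<le> 2 * (e * (h * N)\<^sup>2)"
        using d(2)[of "h *\<^sub>R u" "h *\<^sub>R v"] d(2)[of "h *\<^sub>R v" "h *\<^sub>R u"] h
        unfolding hN by (simp add: add_ac)
      also have "(h *\<^sub>R u) \<bullet> (X *v (h *\<^sub>R v)) - (h *\<^sub>R v) \<bullet> (X *v (h *\<^sub>R u))
          = h\<^sup>2 * (u \<bullet> (X *v v) - v \<bullet> (X *v u))"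
        by (simp add: matrix_vector_mult_scaleR power2_eq_square right_diff_distrib)
      finally have "h\<^sup>2 * \<bar>u \<bullet> (X *v v) - v \<bullet> (X *v u)\<bar> \<le> h\<^sup>2 * (2 * e * N\<^sup>2)"
        by (simp add: abs_mult power_mult_distrib mult_ac)
      then show ?thesis
        using h by simp
    qed
    note bound = this
    have "\<bar>u \<bullet> (X *v v) - v \<bullet> (X *v u)\<bar> \<le> 0 + e" if "0 < e" for e
    proof -
      \<comment> \<open>The summand 1 avoids a division by zero when \<open>u\<close> and
        \<open>v\<close> both vanish.\<close>
      define c where "c = e / (N\<^sup>2 + 1)"
      have pos: "0 < N\<^sup>2 + 1"
        by (simp add: add_nonneg_pos)
      with that have "0 < c" "c * N\<^sup>2 \<le> e"
        by (simp_all add: c_def field_simps)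
      then show ?thesis
        using bound[of "c / 2"] by simp
    qed
    then have "\<bar>u \<bullet> (X *v v) - v \<bullet> (X *v u)\<bar> \<le> 0"
      by (rule field_le_epsilon)
    then show ?thesis
      by simp
  qed
  have "X $ i $ j = X $ j $ i" for i j
    using sym[of "axis i 1" "axis j 1"]
    by (simp add: matrix_vector_mult_basis inner_axis' column_def)
  then show ?thesis
    by (simp add: sym_mats_def transpose_def vec_eq_iff)
qed

lemma sym_mats_inner:
  assumes "X \<in> sym_mats"
  shows "u \<bullet> (X *v v) = (X *v u) \<bullet> v"
  using assms dot_lmul_matrix[of u X v] transpose_matrix_vector[of X u] by (simp add: sym_mats_def)

lemma hess_sym:
  assumes "open \<Omega>" "C2_on \<Omega> \<phi>" "x \<in> \<Omega>"
  shows "hess \<phi> x \<in> sym_mats"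
  using assms(2,3) unfolding C2_on_def
  by (intro second_derivative_symmetric[OF assms(1,3) _ hess_has_derivative]) auto

section \<open>Second-order conditions at a local maximum\<close>

text \<open>Once the gradient vanishes, the Taylor bound at \<open>x + t *\<^sub>R \<xi>\<close>
  with small \<open>t\<close> leaves only its quadratic part, which cannot be positive at a maximum.
  So the Hessian form at \<xi> is at most e |\<xi>|^2 for every positive \<open>e\<close>.\<close>

lemma hess_nonpos_at_local_max:
  fixes x :: "real^'n"
  assumes "open \<Omega>" "C2_on \<Omega> \<phi>" "x \<in> \<Omega>" and max: "\<forall>\<^sub>F y in at x. \<phi> y \<le> \<phi> x"
  shows "grad \<phi> x = 0" and "sym_le (hess \<phi> x) 0"
proof -
  have diff: "\<And>y. y \<in> \<Omega> \<Longrightarrow> \<phi> differentiable (at y)"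
    and X: "(grad \<phi> has_derivative (\<lambda>h. hess \<phi> x *v h)) (at x)"
    using assms hess_has_derivative by (auto simp: C2_on_def)
  obtain d where d: "0 < d" "\<And>y. dist y x < d \<Longrightarrow> \<phi> y \<le> \<phi> x"
    using max eventually_nhds_conv_at[of "\<lambda>y. \<phi> y \<le> \<phi> x" x]
    unfolding eventually_nhds_metric by auto
  have "(\<lambda>h. grad \<phi> x \<bullet> h) = (\<lambda>h. 0)"
    by (rule differential_zero_maxmin[of x "ball x d" \<phi>,
          OF _ open_ball grad_has_derivative[OF diff[OF \<open>x \<in> \<Omega>\<close>]]])
      (use d in \<open>auto simp: dist_commute\<close>)
  then have "grad \<phi> x \<bullet> grad \<phi> x = 0"
    by (rule fun_cong)
  then show g0: "grad \<phi> x = 0"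
    by simp
  show "sym_le (hess \<phi> x) 0"
    unfolding sym_le_def
  proof
    fix \<xi> :: "real^'n"
    have "\<xi> \<bullet> (hess \<phi> x *v \<xi>) \<le> e * (norm \<xi>)\<^sup>2" if "0 < e" for e
    proof -
      obtain d' where d': "0 < d'"
        "\<And>z. norm z < d' \<Longrightarrow> \<phi> x + grad \<phi> x \<bullet> z +
          (z \<bullet> (hess \<phi> x *v z) - e * (norm z)\<^sup>2) / 2 \<le> \<phi> (x + z)"
        using taylor_lower_bound[OF \<open>open \<Omega>\<close> \<open>x \<in> \<Omega>\<close> diff X \<open>0 < e\<close>] by blast
      \<comment> \<open>Small enough for both the maximum property and the Taylor bound at
        \<open>t *\<^sub>R \<xi>\<close>; the summand 1 covers \<xi> = 0.\<close>
      define t where "t = min d d' / (2 * (norm \<xi> + 1))"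
      have pos: "0 < norm \<xi> + 1"
        by (simp add: add_nonneg_pos)
      have t: "0 < t"
        using d(1) d'(1) pos by (simp add: t_def)
      have "t * norm \<xi> < t * (2 * (norm \<xi> + 1))"
        using t pos by (intro mult_strict_left_mono) auto
      also have "\<dots> = min d d'"
        using pos by (simp add: t_def)
      finally have small: "norm (t *\<^sub>R \<xi>) < min d d'"
        using t by simp
      have "\<phi> x + t\<^sup>2 * (\<xi> \<bullet> (hess \<phi> x *v \<xi>) - e * (norm \<xi>)\<^sup>2) / 2 \<le> \<phi> (x + t *\<^sub>R \<xi>)"
        using d'(2)[of "t *\<^sub>R \<xi>"] small g0 t
        by (simp add: power2_eq_square algebra_simps)
      moreover have "\<phi> (x + t *\<^sub>R \<xi>) \<le> \<phi> x"
        using d(2)[of "x + t *\<^sub>R \<xi>"] small by (simp add: dist_norm)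
      ultimately have "t\<^sup>2 * (\<xi> \<bullet> (hess \<phi> x *v \<xi>) - e * (norm \<xi>)\<^sup>2) \<le> 0"
        by simp
      then show ?thesis
        using t by (simp add: mult_le_0_iff)
    qed
    note bound = this
    have "\<xi> \<bullet> (hess \<phi> x *v \<xi>) \<le> 0 + e" if "0 < e" for e
    proof -
      define c where "c = e / ((norm \<xi>)\<^sup>2 + 1)"
      have "0 < (norm \<xi>)\<^sup>2 + 1"
        by (simp add: add_nonneg_pos)
      with that have "0 < c" "c * (norm \<xi>)\<^sup>2 \<le> e"
        by (simp_all add: c_def field_simps)
      then show ?thesis
        using bound[of c] by simp
    qed
    then have "\<xi> \<bullet> (hess \<phi> x *v \<xi>) \<le> 0"
      by (rule field_le_epsilon)
    then show "\<xi> \<bullet> (hess \<phi> x *v \<xi>) \<le> \<xi> \<bullet> (0 *v \<xi>)"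
      by simp
  qed
qed

section \<open>Quadratic test functions with a quartic penalty\<close>

text \<open>The penalty is the fourth power of the distance to \<open>a\<close>, written as a
  polynomial so that it can be differentiated at \<open>a\<close> like anywhere else.\<close>

definition quartic_test :: "real^'n \<Rightarrow> real^'n \<Rightarrow> real^'n^'n \<Rightarrow> real \<Rightarrow> real^'n \<Rightarrow> real" where
  "quartic_test a p Y M x = p \<bullet> (x - a) + (x - a) \<bullet> (Y *v (x - a)) / 2 - M * ((x - a) \<bullet> (x - a))\<^sup>2"

lemma quartic_test_has_derivative:
  assumes "Y \<in> sym_mats"
  shows "(quartic_test a p Y M has_derivative
      (\<lambda>h. (p + Y *v (x - a) - (4 * M * ((x - a) \<bullet> (x - a))) *\<^sub>R (x - a)) \<bullet> h)) (at x)"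
proof -
  define z where "z = x - a"
  have "p \<bullet> h + (z \<bullet> (Y *v h) + h \<bullet> (Y *v z)) / 2 - M * ((2 * (z \<bullet> h) + 2 * (h \<bullet> z)) * (z \<bullet> z))
      = (p + Y *v z - (4 * M * (z \<bullet> z)) *\<^sub>R z) \<bullet> h" for h
    \<comment> \<open>Symmetry of \<open>Y\<close> makes the two terms from the quadratic form
      equal, which cancels the factor 1/2.\<close>
    using sym_mats_inner[OF assms, of z h]
    by (simp add: inner_add_left inner_diff_left inner_commute[of h])
  then show ?thesis
    unfolding quartic_test_def[abs_def] z_def
    by - (rule derivative_eq_intros bounded_linear.has_derivative[OF matrix_vector_mul_bounded_linear]
        refl | simp add: fun_eq_iff)+
qed

text \<open>With z = x - a, the derivative of |z|^2 z is |z|^2 I + 2 z z^T; the matrix given by its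
  entries is this rank-one z z^T.\<close>

lemma grad_quartic_test_has_derivative:
  assumes "Y \<in> sym_mats"
  shows "(grad (quartic_test a p Y M) has_derivative
      (\<lambda>h. (Y - (4 * M * ((x - a) \<bullet> (x - a))) *\<^sub>R mat 1
             - (8 * M) *\<^sub>R (\<chi> i j. (x - a) $ i * (x - a) $ j)) *v h)) (at x)"
proof -
  have outer: "(\<chi> i j. z $ i * z $ j) *v h = (z \<bullet> h) *\<^sub>R z" for z h :: "real^'n"
    by (simp add: vec_eq_iff matrix_vector_mult_def inner_vec_def sum_distrib_left sum_distrib_right mult_ac)
  have "grad (quartic_test a p Y M) =
      (\<lambda>x. p + Y *v (x - a) - (4 * M * ((x - a) \<bullet> (x - a))) *\<^sub>R (x - a))"
    using grad_eqI[OF quartic_test_has_derivative[OF assms]] by (rule ext)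
  moreover have "((\<lambda>x. p + Y *v (x - a) - (4 * M * ((x - a) \<bullet> (x - a))) *\<^sub>R (x - a)) has_derivative
      (\<lambda>h. (Y - (4 * M * ((x - a) \<bullet> (x - a))) *\<^sub>R mat 1
             - (8 * M) *\<^sub>R (\<chi> i j. (x - a) $ i * (x - a) $ j)) *v h)) (at x)"
    by (rule derivative_eq_intros bounded_linear.has_derivative[OF matrix_vector_mul_bounded_linear]
        refl | simp)+
      (simp add: fun_eq_iff matrix_vector_mult_diff_rdistrib outer[of "x - a", simplified] inner_commute
         flip: scaleR_matrix_vector_assoc scaleR_left.add)
  ultimately show ?thesis
    by simp
qed

lemma C2_on_quartic_test:
  assumes "Y \<in> sym_mats"
  shows "C2_on \<Omega> (quartic_test a p Y M)"
proof -
  have "hess (quartic_test a p Y M) = (\<lambda>x. Y - (4 * M * ((x - a) \<bullet> (x - a))) *\<^sub>R mat 1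
             - (8 * M) *\<^sub>R (\<chi> i j. (x - a) $ i * (x - a) $ j))"
    using hess_eqI[OF grad_quartic_test_has_derivative[OF assms]] by (rule ext)
  then have "continuous_on \<Omega> (hess (quartic_test a p Y M))"
    by (auto intro!: continuous_intros)
  then show ?thesis
    using quartic_test_has_derivative[OF assms] grad_quartic_test_has_derivative[OF assms]
    unfolding C2_on_def differentiable_def by blast
qed

lemma quartic_test_nonpos_away:
  fixes p :: "real^'n" and Y :: "real^'n^'n"
  assumes "0 < r"
  obtains M where "0 \<le> M" and "\<And>a x. r \<le> norm (x - a) \<Longrightarrow> quartic_test a p Y M x \<le> 0"
proof
  define K where "K = onorm ((*v) Y)"
  have K: "0 \<le> K"
    by (simp add: K_def onorm_pos_le)
  \<comment> \<open>For |z| at least \<open>r\<close>, one summand times |z|^4 dominates the linear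
    term, the other the quadratic form. The choice is independent of the centre
    \<open>a\<close>.\<close>
  let ?M = "norm p / r ^ 3 + K / r\<^sup>2"
  show "0 \<le> ?M"
    using K \<open>0 < r\<close> by simp
  show "quartic_test a p Y ?M x \<le> 0" if r: "r \<le> norm (x - a)" for a x
  proof -
    define z where "z = x - a"
    have z: "r \<le> norm z"
      using r by (simp add: z_def)
    have "p \<bullet> z \<le> norm p * norm z"
      by (rule norm_cauchy_schwarz)
    also have "\<dots> = norm p / r ^ 3 * (r ^ 3 * norm z)"
      using \<open>0 < r\<close> by simp
    also have "\<dots> \<le> norm p / r ^ 3 * ((norm z) ^ 3 * norm z)"
      using z \<open>0 < r\<close> by (intro mult_left_mono mult_right_mono power_mono) auto
    finally have 1: "p \<bullet> z \<le> norm p / r ^ 3 * (norm z) ^ 4"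
      by (simp add: power_numeral_reduce mult_ac)
    have "z \<bullet> (Y *v z) \<le> norm z * norm (Y *v z)"
      by (rule norm_cauchy_schwarz)
    also have "\<dots> \<le> norm z * (K * norm z)"
      unfolding K_def by (intro mult_left_mono onorm) auto
    also have "\<dots> = K / r\<^sup>2 * (r\<^sup>2 * (norm z)\<^sup>2)"
      using \<open>0 < r\<close> by (simp add: power2_eq_square)
    also have "\<dots> \<le> K / r\<^sup>2 * ((norm z)\<^sup>2 * (norm z)\<^sup>2)"
      using z K \<open>0 < r\<close> by (intro mult_left_mono mult_right_mono power_mono) auto
    finally have 2: "z \<bullet> (Y *v z) \<le> K / r\<^sup>2 * (norm z) ^ 4"
      by (simp flip: power_add)
    \<comment> \<open>The test function contains only half of the quadratic form; half of its bound
      is at most the whole bound because that is nonnegative.\<close>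
    have 3: "0 \<le> K / r\<^sup>2 * (norm z) ^ 4"
      using K by simp
    have "(z \<bullet> z)\<^sup>2 = (norm z) ^ 4"
      by (simp add: dot_square_norm flip: power_mult)
    then show ?thesis
      using 1 2 3 unfolding quartic_test_def z_def[symmetric] by (simp add: distrib_right)
  qed
qed

lemma sym_mats_diff_scaleR_mat:
  assumes "X \<in> sym_mats"
  shows "X - e *\<^sub>R mat 1 \<in> sym_mats"
  using assms by (auto simp: sym_mats_def transpose_def vec_eq_iff mat_def)

section \<open>Localizing condition (G)\<close>

text \<open>The replacement test function vanishes at \<open>a\<close> by construction, so \<phi>(a)
  may be arbitrary and \<open>F\<close> is evaluated at the value 0.\<close>

lemma G_cond_local:
  assumes "open \<Omega>" and "F1 \<Omega> F" and G: "G_cond F \<Omega> U"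
    and \<phi>: "C2_on \<Omega> \<phi>" and a: "a \<in> \<Omega> - U"
    and max: "\<forall>\<^sub>F x in at a within \<Omega>. x \<notin> U \<longrightarrow> \<phi> x \<le> \<phi> a"
  shows "F a 0 (grad \<phi> a) (hess \<phi> a) \<le> 0"
proof -
  define p where "p = grad \<phi> a"
  define X where "X = hess \<phi> a"
  have X_sym: "X \<in> sym_mats"
    unfolding X_def using hess_sym[OF \<open>open \<Omega>\<close> \<phi>] a by blast
  have "a \<in> \<Omega>" and diff: "\<And>y. y \<in> \<Omega> \<Longrightarrow> \<phi> differentiable (at y)"
    and X: "(grad \<phi> has_derivative (\<lambda>h. X *v h)) (at a)"
    using \<phi> a hess_has_derivative by (auto simp: C2_on_def X_def)
  have "\<forall>\<^sub>F x in nhds a. x \<in> \<Omega> - U \<longrightarrow> \<phi> x \<le> \<phi> a"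
    using max unfolding eventually_at_filter by eventually_elim auto
  then obtain d where d: "0 < d" "\<And>x. x \<in> \<Omega> - U \<Longrightarrow> dist x a < d \<Longrightarrow> \<phi> x \<le> \<phi> a"
    unfolding eventually_nhds_metric by blast
  have perturbed: "F a 0 p (X - e *\<^sub>R mat 1) \<le> 0" if "0 < e" for e
  proof -
    obtain d' where d': "0 < d'"
      "\<And>z. norm z < d' \<Longrightarrow>
        \<phi> a + p \<bullet> z + (z \<bullet> (X *v z) - e * (norm z)\<^sup>2) / 2 \<le> \<phi> (a + z)"
      using taylor_lower_bound[OF \<open>open \<Omega>\<close> \<open>a \<in> \<Omega>\<close> diff X \<open>0 < e\<close>] unfolding p_def by blast
    define Y where "Y = X - e *\<^sub>R mat 1"
    have Y: "Y \<in> sym_mats"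
      unfolding Y_def by (rule sym_mats_diff_scaleR_mat[OF X_sym])
    have "0 < min d d'"
      using d(1) d'(1) by simp
    then obtain M where M: "0 \<le> M"
      "\<And>a x. min d d' \<le> norm (x - a) \<Longrightarrow> quartic_test a p Y M x \<le> 0"
      using quartic_test_nonpos_away[where p = p and Y = Y] by blast
    define \<psi> where "\<psi> = quartic_test a p Y M"
    have \<psi>a: "\<psi> a = 0"
      by (simp add: \<psi>_def quartic_test_def)
    have "\<psi> x \<le> \<psi> a" if x: "x \<in> \<Omega> - U" for x
    proof (cases "norm (x - a) < min d d'")
      case True
      \<comment> \<open>Near \<open>a\<close>, the Taylor bound puts the quadratic part of \<psi>(x)
        below \<phi>(x) - \<phi>(a), which is nonpositive outside \<open>U\<close>; the penalty only
        lowers \<psi>.\<close>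
      have "0 \<le> M * ((x - a) \<bullet> (x - a))\<^sup>2"
        using M(1) by simp
      moreover have "\<phi> x \<le> \<phi> a"
        using d(2)[OF x] True by (simp add: dist_norm)
      moreover have "(x - a) \<bullet> (Y *v (x - a)) = (x - a) \<bullet> (X *v (x - a)) - e * (norm (x - a))\<^sup>2"
        by (simp add: Y_def matrix_vector_mult_diff_rdistrib inner_diff_right dot_square_norm
            flip: scaleR_matrix_vector_assoc)
      ultimately show ?thesis
        using d'(2)[of "x - a"] True unfolding \<psi>a unfolding \<psi>_def quartic_test_def by simp
    next
      case False
      then show ?thesis
        unfolding \<psi>a unfolding \<psi>_def by (intro M(2)) linarith
    qed
    then have "F a (\<psi> a) (grad \<psi> a) (hess \<psi> a) \<le> 0"
      using G a \<psi>a C2_on_quartic_test[OF Y] unfolding G_cond_def \<psi>_def by blast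
    moreover have "grad \<psi> a = p"
      using grad_eqI[OF quartic_test_has_derivative[OF Y, of a p M a]] by (simp add: \<psi>_def)
    moreover have "hess \<psi> a = Y"
      using hess_eqI[OF grad_quartic_test_has_derivative[OF Y, of a p M a]] by (simp add: \<psi>_def flip: zero_vec_def)
    ultimately show ?thesis
      by (simp add: \<psi>a Y_def)
  qed
  \<comment> \<open>(F1) gives continuity on symmetric matrices only, and the path e \<mapsto> X -
    eI stays among them.\<close>
  have "continuous_on UNIV (\<lambda>e. (\<lambda>(x, r, p, X). F x r p X) (a, 0, p, X - e *\<^sub>R mat 1))"
    by (rule continuous_on_compose2[OF \<open>F1 \<Omega> F\<close>[unfolded F1_def]])
      (use \<open>a \<in> \<Omega>\<close> sym_mats_diff_scaleR_mat[OF X_sym] in \<open>auto intro!: continuous_intros\<close>)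
  then have "isCont (\<lambda>e. F a 0 p (X - e *\<^sub>R mat 1)) 0"
    by (simp add: continuous_on_eq_continuous_at)
  then have "((\<lambda>e. F a 0 p (X - e *\<^sub>R mat 1)) \<longlongrightarrow> F a 0 p X) (at_right 0)"
    by (auto simp: isCont_def intro: filterlim_mono at_le)
  moreover have "\<forall>\<^sub>F e in at_right (0::real). F a 0 p (X - e *\<^sub>R mat 1) \<le> 0"
    using eventually_at_right_less[of 0] perturbed by (auto elim: eventually_mono)
  ultimately show ?thesis
    unfolding p_def X_def by (rule tendsto_upperbound) simp
qed

section \<open>The indicator function as supersolution\<close>

theorem theorem2:
  fixes \<Omega> U :: "(real^'n) set"
    and F :: "real^'n \<Rightarrow> real \<Rightarrow> real^'n \<Rightarrow> real^'n^'n \<Rightarrow> real"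
  assumes "open \<Omega>"
    and "F1 \<Omega> F" and "F2 \<Omega> F" and "F3 \<Omega> F" and "F5 \<Omega> F"
    and "open U" and "U \<subseteq> \<Omega>"
    and "U \<noteq> \<Omega>"
    and "G_cond F \<Omega> U"
  shows "\<exists>v. viscosity_supersolution F \<Omega> v \<and>
             (\<forall>x\<in>\<Omega>. 0 \<le> v x) \<and> (\<exists>x\<in>\<Omega>. v x = 0) \<and>
             U = {x \<in> \<Omega>. v x > 0}"
proof (intro exI conjI)
  let ?v = "\<lambda>x. indicator U x :: real"
  have near_U: "\<forall>\<^sub>F y in at x within S. y \<in> U" if "x \<in> U" for x S
    using eventually_nhds_in_open[OF \<open>open U\<close> that]
    by (auto simp: eventually_at_filter elim: eventually_mono)
  show "viscosity_supersolution F \<Omega> ?v"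
    unfolding viscosity_supersolution_def
  proof (intro conjI allI impI)
    show "LSC \<Omega> ?v"
      unfolding LSC_def
    proof (intro ballI allI impI)
      fix x a
      assume a: "a < ?v x"
      show "\<forall>\<^sub>F y in at x within \<Omega>. a < ?v y"
      proof (cases "x \<in> U")
        case True
        from near_U[OF True] show ?thesis
          by eventually_elim (use a True in simp)
      next
        case False
        \<comment> \<open>At a point outside \<open>U\<close> the indicator takes its least value 0,
          so every value of it exceeds the given bound.\<close>
        with a have "a < ?v y" for y
          by (simp add: indicator_def)
        then show ?thesis
          by simp
      qed
    qed
  next
    fix \<phi> a
    assume "C2_on \<Omega> \<phi> \<and> local_min_on \<Omega> (\<lambda>x. ?v x - \<phi> x) a"
    then have \<phi>: "C2_on \<Omega> \<phi>" and "a \<in> \<Omega>"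
      and min: "\<forall>\<^sub>F x in at a within \<Omega>. ?v a - \<phi> a \<le> ?v x - \<phi> x"
      by (auto simp: local_min_on_def)
    show "F a (?v a) (grad \<phi> a) (hess \<phi> a) \<le> 0"
    proof (cases "a \<in> U")
      case True
      \<comment> \<open>The indicator is constantly 1 near \<open>a\<close> because \<open>U\<close>
        is open, so a local minimum of the difference is a local maximum of \<phi>.\<close>
      have "\<forall>\<^sub>F x in at a within \<Omega>. \<phi> x \<le> \<phi> a"
        using min near_U[OF True] by eventually_elim (use True in simp)
      then have "\<forall>\<^sub>F x in at a. \<phi> x \<le> \<phi> a"
        by (simp add: at_within_open[OF \<open>a \<in> \<Omega>\<close> \<open>open \<Omega>\<close>])
      note max = hess_nonpos_at_local_max[OF \<open>open \<Omega>\<close> \<phi> \<open>a \<in> \<Omega>\<close> this]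
      have X: "hess \<phi> a \<in> sym_mats" "(0 :: real^'n^'n) \<in> sym_mats"
        using hess_sym[OF \<open>open \<Omega>\<close> \<phi> \<open>a \<in> \<Omega>\<close>]
        by (auto simp: sym_mats_def transpose_def vec_eq_iff)
      have "F a 1 0 (hess \<phi> a) \<le> F a 0 0 (hess \<phi> a)"
        using \<open>F5 \<Omega> F\<close> \<open>a \<in> \<Omega>\<close> X by (simp add: F5_def)
      also have "\<dots> \<le> F a 0 0 0"
        using \<open>F2 \<Omega> F\<close> \<open>a \<in> \<Omega>\<close> X max(2) by (simp add: F2_def)
      also have "\<dots> \<le> 0"
        using \<open>F3 \<Omega> F\<close> \<open>a \<in> \<Omega>\<close> by (simp add: F3_def)
      finally show ?thesis
        using True max(1) by simp
    next
      case False
      \<comment> \<open>Both indicator values are 0 when \<open>x\<close> is outside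
        \<open>U\<close>. At points of \<open>U\<close> the jump to 1 leaves \<phi> unconstrained,
        hence the implication.\<close>
      have "\<forall>\<^sub>F x in at a within \<Omega>. x \<notin> U \<longrightarrow> \<phi> x \<le> \<phi> a"
        using min by eventually_elim (use False in auto)
      then show ?thesis
        using G_cond_local[OF \<open>open \<Omega>\<close> \<open>F1 \<Omega> F\<close> \<open>G_cond F \<Omega> U\<close> \<phi>] False \<open>a \<in> \<Omega>\<close> by simp
    qed
  qed
  show "\<forall>x\<in>\<Omega>. 0 \<le> ?v x"
    by simp
  show "\<exists>x\<in>\<Omega>. ?v x = 0"
    using \<open>U \<subseteq> \<Omega>\<close> \<open>U \<noteq> \<Omega>\<close> by (auto simp: indicator_def)
  show "U = {x \<in> \<Omega>. ?v x > 0}"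
    using \<open>U \<subseteq> \<Omega>\<close> by (auto simp: indicator_def)
qed

end
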